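(* Let $\mathfrak g_1,\mathfrak g_2$ be finite-dimensional Lie algebras over $\mathbb R$ or $\mathbb C$, let $\mathfrak g=\mathfrak g_1\times\mathfrak g_2$, and let $\pi_i\colon\mathfrak g\to\mathfrak g_i$, $i=1,2$, be the natural projections. Consider the map $\Phi$ that assigns to each Lie subalgebra $\mathfrak h\subset\mathfrak g$ the tuple $(\mathfrak h_1,\mathfrak h_2,I,\alpha)$, where $$\mathfrak h_i:=\pi_i(\mathfrak h),\quad I:=\mathfrak h\cap\mathfrak g_2,\quad \alpha\colon\mathfrak h_1\ni x_1\longmapsto\{x_2\in\mathfrak h_2\mid(x_1,x_2)\in\mathfrak h\}\in\mathfrak h_2/I.$$ Then $\Phi$ is a well-defined map from the set of Lie subalgebras of $\mathfrak g$ to the set of quadruples $(\mathfrak h_1,\mathfrak h_2,I,\alpha)$ in which $\mathfrak h_i\subset\mathfrak g_i$, $i=1,2$, are Lie subalgebras, $I$ is an ideal of $\mathfrak h_2$ and $\alpha\colon\mathfrak h_1\to\mathfrak h_2/I$ is a Lie algebra epimorphism. Moreover, $\Phi$ has an inverse, which maps such a quadruple to the Lie subalgebra of $\mathfrak g$ given by $$\Phi^{-1}\colon(\mathfrak h_1,\mathfrak h_2,I,\alpha)\longmapsto\mathfrak h:=\{(x_1,x_2)\mid x_1\in\mathfrak h_1,\ x_2\in\alpha(x_1)\}.$$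
   Context: $\mathfrak g_2$ is identified with the ideal $\{0\}\times\mathfrak g_2$ of $\mathfrak g$, so $\mathfrak h\cap\mathfrak g_2$ is regarded as a subset of $\mathfrak g_2$. Elements of the quotient $\mathfrak h_2/I$ are regarded as cosets, i.e. subsets of $\mathfrak h_2$. *)

theory Defs
  imports "HOL-Analysis.Product_Vector" "HOL-Library.FuncSet"
begin

definition field_iso :: "('k::field \<Rightarrow> 'l::field) \<Rightarrow> bool" where
  "field_iso f \<longleftrightarrow> bij f \<and> f 1 = 1 \<and>
     (\<forall>x y. f (x + y) = f x + f y) \<and> (\<forall>x y. f (x * y) = f x * f y)"

definition real_or_complex_field :: "'k::field itself \<Rightarrow> bool" where
  "real_or_complex_field _ \<longleftrightarrow>
     (\<exists>f :: 'k \<Rightarrow> real. field_iso f) \<or> (\<exists>f :: 'k \<Rightarrow> complex. field_iso f)"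

lemma real_or_complex_field_real: "real_or_complex_field TYPE(real)"
  unfolding real_or_complex_field_def field_iso_def
  by (intro disjI1 exI[of _ "\<lambda>x. x"]) (simp add: bij_def)

lemma real_or_complex_field_complex: "real_or_complex_field TYPE(complex)"
  unfolding real_or_complex_field_def field_iso_def
  by (intro disjI2 exI[of _ "\<lambda>x. x"]) (simp add: bij_def)

locale lie_algebra = vector_space scale
  for scale :: "'k::field \<Rightarrow> 'v::ab_group_add \<Rightarrow> 'v" +
  fixes bracket :: "'v \<Rightarrow> 'v \<Rightarrow> 'v"
  assumes bracket_add_left: "bracket (x + y) z = bracket x z + bracket y z"
    and bracket_add_right: "bracket x (y + z) = bracket x y + bracket x z"
    and bracket_scale_left: "bracket (scale c x) y = scale c (bracket x y)"
    and bracket_scale_right: "bracket x (scale c y) = scale c (bracket x y)"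
    and bracket_self: "bracket x x = 0"
    and jacobi:
      "bracket x (bracket y z) + bracket y (bracket z x) + bracket z (bracket x y) = 0"

locale finite_dimensional_lie_algebra = lie_algebra scale bracket
  for scale :: "'k::field \<Rightarrow> 'v::ab_group_add \<Rightarrow> 'v" and bracket +
  assumes ex_finite_basis: "\<exists>B. finite_dimensional_vector_space scale B"

definition lie_subalgebra ::
  "('k::field \<Rightarrow> 'v::ab_group_add \<Rightarrow> 'v) \<Rightarrow> ('v \<Rightarrow> 'v \<Rightarrow> 'v) \<Rightarrow> 'v set \<Rightarrow> bool" where
  "lie_subalgebra s b h \<longleftrightarrow>
     module.subspace s h \<and> (\<forall>x\<in>h. \<forall>y\<in>h. b x y \<in> h)"

text \<open>One-sided closure suffices, since the bracket is skew-symmetric.\<close>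

definition lie_ideal ::
  "('k::field \<Rightarrow> 'v::ab_group_add \<Rightarrow> 'v) \<Rightarrow> ('v \<Rightarrow> 'v \<Rightarrow> 'v) \<Rightarrow> 'v set \<Rightarrow> 'v set \<Rightarrow> bool" where
  "lie_ideal s b h I \<longleftrightarrow>
     I \<subseteq> h \<and> module.subspace s I \<and> (\<forall>x\<in>h. \<forall>y\<in>I. b x y \<in> I)"

text \<open>The underlying vector space of the product is given by \<open>module_prod.scale\<close>.\<close>

definition prod_bracket ::
  "('a \<Rightarrow> 'a \<Rightarrow> 'a) \<Rightarrow> ('b \<Rightarrow> 'b \<Rightarrow> 'b) \<Rightarrow> 'a \<times> 'b \<Rightarrow> 'a \<times> 'b \<Rightarrow> 'a \<times> 'b" where
  "prod_bracket b1 b2 x y = (b1 (fst x) (fst y), b2 (snd x) (snd y))"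

lemma lie_algebra_prod:
  assumes "lie_algebra s1 b1" and "lie_algebra s2 b2"
  shows "lie_algebra (module_prod.scale s1 s2) (prod_bracket b1 b2)"
proof -
  interpret L1: lie_algebra s1 b1 by fact
  interpret L2: lie_algebra s2 b2 by fact
  interpret vector_space_prod s1 s2 ..
  show ?thesis
    by unfold_locales
      (simp_all add: prod_bracket_def scale_def prod_eq_iff
        L1.bracket_add_left L1.bracket_add_right L1.bracket_scale_left L1.bracket_scale_right
        L1.bracket_self L1.jacobi
        L2.bracket_add_left L2.bracket_add_right L2.bracket_scale_left L2.bracket_scale_right
        L2.bracket_self L2.jacobi)
qed

text \<open>
  A subalgebra and a quotient are carried by a set of vectors and a set of cosets respectively.
  The record collects the operations, so that homomorphisms between such structures can be stated.
\<close>

record ('k, 'v) lie_structure =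
  lie_carrier :: "'v set"
  lie_add :: "'v \<Rightarrow> 'v \<Rightarrow> 'v"
  lie_scale :: "'k \<Rightarrow> 'v \<Rightarrow> 'v"
  lie_bracket :: "'v \<Rightarrow> 'v \<Rightarrow> 'v"

definition lie_restrict ::
  "('k::field \<Rightarrow> 'v::ab_group_add \<Rightarrow> 'v) \<Rightarrow> ('v \<Rightarrow> 'v \<Rightarrow> 'v) \<Rightarrow> 'v set
     \<Rightarrow> ('k, 'v) lie_structure" where
  "lie_restrict s b h =
     \<lparr>lie_carrier = h, lie_add = (+), lie_scale = s, lie_bracket = b\<rparr>"

definition coset :: "'v::ab_group_add set \<Rightarrow> 'v \<Rightarrow> 'v set" where
  "coset I x = (\<lambda>y. x + y) ` I"

text \<open>
  The operations on cosets are induced from representatives; the union is over all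
  representatives, which contribute the same coset.
\<close>

definition lie_quotient ::
  "('k::field \<Rightarrow> 'v::ab_group_add \<Rightarrow> 'v) \<Rightarrow> ('v \<Rightarrow> 'v \<Rightarrow> 'v) \<Rightarrow> 'v set \<Rightarrow> 'v set
     \<Rightarrow> ('k, 'v set) lie_structure" where
  "lie_quotient s b h I =
     \<lparr>lie_carrier = coset I ` h,
      lie_add = (\<lambda>A B. \<Union>x\<in>A. \<Union>y\<in>B. coset I (x + y)),
      lie_scale = (\<lambda>c A. \<Union>x\<in>A. coset I (s c x)),
      lie_bracket = (\<lambda>A B. \<Union>x\<in>A. \<Union>y\<in>B. coset I (b x y))\<rparr>"

definition lie_hom ::
  "('k, 'v) lie_structure \<Rightarrow> ('k, 'w) lie_structure \<Rightarrow> ('v \<Rightarrow> 'w) \<Rightarrow> bool" where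
  "lie_hom L M f \<longleftrightarrow>
     f \<in> lie_carrier L \<rightarrow> lie_carrier M \<and>
     (\<forall>x\<in>lie_carrier L. \<forall>y\<in>lie_carrier L. f (lie_add L x y) = lie_add M (f x) (f y)) \<and>
     (\<forall>c. \<forall>x\<in>lie_carrier L. f (lie_scale L c x) = lie_scale M c (f x)) \<and>
     (\<forall>x\<in>lie_carrier L. \<forall>y\<in>lie_carrier L.
        f (lie_bracket L x y) = lie_bracket M (f x) (f y))"

definition lie_epi ::
  "('k, 'v) lie_structure \<Rightarrow> ('k, 'w) lie_structure \<Rightarrow> ('v \<Rightarrow> 'w) \<Rightarrow> bool" where
  "lie_epi L M f \<longleftrightarrow> lie_hom L M f \<and> f ` lie_carrier L = lie_carrier M"

lemma UN_UN_eq: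
  assumes "x \<in> A" "y \<in> B" and eq: "\<And>u v. u \<in> A \<Longrightarrow> v \<in> B \<Longrightarrow> f u v = C"
  shows "(\<Union>u\<in>A. \<Union>v\<in>B. f u v) = C"
proof -
  have "(\<Union>u\<in>A. \<Union>v\<in>B. f u v) = (\<Union>u\<in>A. \<Union>v\<in>B. C)" by (simp add: eq)
  also have "\<dots> = C" using assms(1,2) by auto
  finally show ?thesis .
qed

context lie_algebra
begin

lemma coset_eq_iff:
  assumes "subspace I"
  shows "coset I x = coset I y \<longleftrightarrow> x - y \<in> I"
proof
  assume "coset I x = coset I y"
  moreover have "x \<in> coset I x"
    using subspace_0[OF assms] by (force simp: coset_def)
  ultimately show "x - y \<in> I" by (auto simp: coset_def)
next
  assume d: "x - y \<in> I"
  have "coset I x \<subseteq> coset I y"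
  proof
    fix z assume "z \<in> coset I x"
    then obtain i where i: "i \<in> I" "z = x + i" by (auto simp: coset_def)
    then have "z = y + ((x - y) + i)" by simp
    with subspace_add[OF assms d i(1)] show "z \<in> coset I y" unfolding coset_def by blast
  qed
  moreover have "coset I y \<subseteq> coset I x"
  proof
    fix z assume "z \<in> coset I y"
    then obtain i where i: "i \<in> I" "z = y + i" by (auto simp: coset_def)
    then have "z = x + (i - (x - y))" by simp
    with subspace_diff[OF assms i(1) d] show "z \<in> coset I x" unfolding coset_def by blast
  qed
  ultimately show "coset I x = coset I y" by blast
qed

lemma coset_self: "subspace I \<Longrightarrow> x \<in> coset I x"
  using subspace_0 by (force simp: coset_def)

lemma lie_quotient_add:
  assumes "subspace I"
  shows "lie_add (lie_quotient scale bracket h I) (coset I x) (coset I y) = coset I (x + y)"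
proof -
  have "coset I (u + v) = coset I (x + y)" if "u \<in> coset I x" "v \<in> coset I y" for u v
  proof -
    have "u - x \<in> I" "v - y \<in> I" using that by (auto simp: coset_def)
    then have "(u - x) + (v - y) \<in> I" by (rule subspace_add[OF assms])
    then show ?thesis by (simp add: coset_eq_iff[OF assms] algebra_simps)
  qed
  then show ?thesis
    unfolding lie_quotient_def lie_structure.simps
    by (intro UN_UN_eq[OF coset_self[OF assms] coset_self[OF assms]])
qed

lemma lie_quotient_scale:
  assumes "subspace I"
  shows "lie_scale (lie_quotient scale bracket h I) c (coset I x) = coset I (scale c x)"
proof -
  have "coset I (scale c u) = coset I (scale c x)" if "u \<in> coset I x" for u
  proof -
    have "u - x \<in> I" using that by (auto simp: coset_def)
    then have "scale c (u - x) \<in> I" by (rule subspace_scale[OF assms])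
    then show ?thesis by (simp add: coset_eq_iff[OF assms] scale_right_diff_distrib)
  qed
  then have "(\<Union>u\<in>coset I x. coset I (scale c u)) = (\<Union>u\<in>coset I x. coset I (scale c x))"
    by simp
  also have "\<dots> = coset I (scale c x)" using coset_self[OF assms, of x] by auto
  finally show ?thesis by (simp add: lie_quotient_def)
qed

lemma bracket_skew: "bracket x y = - bracket y x"
proof -
  have "0 = bracket (x + y) (x + y)" by (simp add: bracket_self)
  also have "\<dots> = bracket x y + bracket y x"
    unfolding bracket_add_left bracket_add_right by (simp add: bracket_self)
  finally show ?thesis by (metis add.inverse_unique minus_minus neg_eq_iff_add_eq_0)
qed

lemma lie_quotient_bracket:
  assumes h: "lie_subalgebra scale bracket h" and I: "lie_ideal scale bracket h I"
    and x: "x \<in> h" and y: "y \<in> h"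
  shows "lie_bracket (lie_quotient scale bracket h I) (coset I x) (coset I y)
    = coset I (bracket x y)"
proof -
  have sI: "subspace I" and Ih: "I \<subseteq> h"
    and l: "\<And>a i. a \<in> h \<Longrightarrow> i \<in> I \<Longrightarrow> bracket a i \<in> I"
    using I by (auto simp: lie_ideal_def)
  have r: "bracket i a \<in> I" if "a \<in> h" "i \<in> I" for a i
    using subspace_neg[OF sI l[OF that]] bracket_skew[of i a] by simp
  have "coset I (bracket u v) = coset I (bracket x y)"
    if u: "u \<in> coset I x" and v: "v \<in> coset I y" for u v
  proof -
    obtain i j where ij: "i \<in> I" "j \<in> I" "u = x + i" "v = y + j"
      using u v by (auto simp: coset_def)
    have "bracket u v - bracket x y = bracket x j + (bracket i y + bracket i j)"
      unfolding ij(3,4) bracket_add_left bracket_add_right by simp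
    moreover have "\<dots> \<in> I"
      using ij(1,2) Ih x y by (intro subspace_add[OF sI] l r) auto
    ultimately show ?thesis by (simp add: coset_eq_iff[OF sI])
  qed
  then show ?thesis
    unfolding lie_quotient_def lie_structure.simps
    by (intro UN_UN_eq[OF coset_self[OF sI] coset_self[OF sI]])
qed

end

text \<open>
  Maps defined on a subset are extensional functions (value \<open>undefined\<close> outside the subset),
  so that equality of quadruples is equality of the maps on their actual domain.
  The second factor of the product is identified with \<open>{0} \<times> UNIV\<close>.
\<close>

type_synonym ('a, 'b) quadruple = "'a set \<times> 'b set \<times> 'b set \<times> ('a \<Rightarrow> 'b set)"

definition quadruple_of_subalgebra ::
  "('a::ab_group_add \<times> 'b::ab_group_add) set \<Rightarrow> ('a, 'b) quadruple" where
  "quadruple_of_subalgebra h =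
     (fst ` h,
      snd ` h,
      snd ` (h \<inter> {0} \<times> UNIV),
      (\<lambda>x1\<in>fst ` h. {x2 \<in> snd ` h. (x1, x2) \<in> h}))"

definition subalgebra_of_quadruple :: "('a, 'b) quadruple \<Rightarrow> ('a \<times> 'b) set" where
  "subalgebra_of_quadruple = (\<lambda>(h1, h2, I, \<alpha>). {(x1, x2). x1 \<in> h1 \<and> x2 \<in> \<alpha> x1})"

definition lie_quadruples ::
  "('k::field \<Rightarrow> 'a::ab_group_add \<Rightarrow> 'a) \<Rightarrow> ('a \<Rightarrow> 'a \<Rightarrow> 'a)
     \<Rightarrow> ('k \<Rightarrow> 'b::ab_group_add \<Rightarrow> 'b) \<Rightarrow> ('b \<Rightarrow> 'b \<Rightarrow> 'b) \<Rightarrow> ('a, 'b) quadruple set" where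
  "lie_quadruples s1 b1 s2 b2 =
     {(h1, h2, I, \<alpha>).
        lie_subalgebra s1 b1 h1 \<and> lie_subalgebra s2 b2 h2 \<and> lie_ideal s2 b2 h2 I \<and>
        \<alpha> \<in> extensional h1 \<and>
        lie_epi (lie_restrict s1 b1 h1) (lie_quotient s2 b2 h2 I) \<alpha>}"

end

theory Submission
  imports Defs
begin

text \<open>
  This is the Lie algebra version of Goursat's lemma. The fibre of a subalgebra \<open>h\<close> over a point of
  its first projection is a coset of \<open>I\<close>, so closure of \<open>h\<close> under the operations makes \<open>\<alpha>\<close> a
  homomorphism.
  Conversely, \<open>x2 \<in> \<alpha> x1\<close> says that \<open>x2\<close> lies in \<open>h2\<close> and represents the class \<open>\<alpha> x1\<close>,
  a condition preserved by all operations because \<open>\<alpha>\<close> is a homomorphism.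
\<close>

locale lie_algebra_pair = L1: lie_algebra s1 b1 + L2: lie_algebra s2 b2
  for s1 :: "'k::field \<Rightarrow> 'a::ab_group_add \<Rightarrow> 'a" and b1
    and s2 :: "'k \<Rightarrow> 'b::ab_group_add \<Rightarrow> 'b" and b2
begin

abbreviation prod_subalgebra :: "('a \<times> 'b) set \<Rightarrow> bool" where
  "prod_subalgebra \<equiv> lie_subalgebra (module_prod.scale s1 s2) (prod_bracket b1 b2)"

text \<open>In coordinates, closure can be taken apart for the projections and the kernel, and
  checked componentwise for a set built from a quadruple.\<close>

lemma prod_subalgebra_iff:
  "prod_subalgebra h \<longleftrightarrow>
     (0, 0) \<in> h \<and>
     (\<forall>x y u v. (x, y) \<in> h \<longrightarrow> (u, v) \<in> h \<longrightarrow> (x + u, y + v) \<in> h) \<and>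
     (\<forall>c x y. (x, y) \<in> h \<longrightarrow> (s1 c x, s2 c y) \<in> h) \<and>
     (\<forall>x y u v. (x, y) \<in> h \<longrightarrow> (u, v) \<in> h \<longrightarrow> (b1 x u, b2 y v) \<in> h)"
proof -
  interpret P: vector_space_prod s1 s2 ..
  show ?thesis
    by (simp add: lie_subalgebra_def P.p.subspace_def P.scale_def prod_bracket_def
        zero_prod_def Ball_def split_paired_all)
qed

section \<open>From subalgebras to quadruples\<close>

lemma
  assumes "prod_subalgebra h"
  shows lie_subalgebra_fst: "lie_subalgebra s1 b1 (fst ` h)"
    and lie_subalgebra_snd: "lie_subalgebra s2 b2 (snd ` h)"
proof -
  note h = assms[unfolded prod_subalgebra_iff]
  have "0 \<in> fst ` h" "0 \<in> snd ` h" using h by force+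
  moreover have "x + u \<in> fst ` h" "s1 c x \<in> fst ` h" "b1 x u \<in> fst ` h"
    if "x \<in> fst ` h" "u \<in> fst ` h" for x u c
  proof -
    obtain y v where "(x, y) \<in> h" "(u, v) \<in> h" using \<open>x \<in> fst ` h\<close> \<open>u \<in> fst ` h\<close> by auto
    with h have "(x + u, y + v) \<in> h" "(s1 c x, s2 c y) \<in> h" "(b1 x u, b2 y v) \<in> h" by blast+
    then show "x + u \<in> fst ` h" "s1 c x \<in> fst ` h" "b1 x u \<in> fst ` h" by force+
  qed
  moreover have "y + v \<in> snd ` h" "s2 c y \<in> snd ` h" "b2 y v \<in> snd ` h"
    if "y \<in> snd ` h" "v \<in> snd ` h" for y v c
  proof -
    obtain x u where "(x, y) \<in> h" "(u, v) \<in> h" using \<open>y \<in> snd ` h\<close> \<open>v \<in> snd ` h\<close> by auto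
    with h have "(x + u, y + v) \<in> h" "(s1 c x, s2 c y) \<in> h" "(b1 x u, b2 y v) \<in> h" by blast+
    then show "y + v \<in> snd ` h" "s2 c y \<in> snd ` h" "b2 y v \<in> snd ` h" by force+
  qed
  ultimately show "lie_subalgebra s1 b1 (fst ` h)" "lie_subalgebra s2 b2 (snd ` h)"
    by (simp_all add: lie_subalgebra_def L1.subspace_def L2.subspace_def)
qed

text \<open>For a subalgebra \<open>h\<close> this is the kernel of the first projection on
  \<open>h\<close>, read in the second factor; it is the ideal \<open>I\<close> of the
  quadruple.\<close>

definition kernel :: "('a \<times> 'b) set \<Rightarrow> 'b set" where
  "kernel h = snd ` (h \<inter> {0} \<times> UNIV)"

lemma mem_kernel_iff: "y \<in> kernel h \<longleftrightarrow> (0, y) \<in> h"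
  by (force simp: kernel_def)

lemma lie_ideal_kernel:
  assumes "prod_subalgebra h"
  shows "lie_ideal s2 b2 (snd ` h) (kernel h)"
proof -
  have b0: "b1 x 0 = 0" for x
    using L1.bracket_add_right[of x 0 0] by simp
  note h = assms[unfolded prod_subalgebra_iff]
  have "kernel h \<subseteq> snd ` h" by (auto simp: kernel_def)
  moreover have "L2.subspace (kernel h)"
    unfolding L2.subspace_def mem_kernel_iff
  proof (intro conjI allI ballI)
    show "(0, 0) \<in> h" using h by blast
    show "(0, y + v) \<in> h" if "y \<in> kernel h" "v \<in> kernel h" for y v
    proof -
      have "(0 + 0, y + v) \<in> h" using h that unfolding mem_kernel_iff by blast
      then show ?thesis by simp
    qed
    show "(0, s2 c y) \<in> h" if "y \<in> kernel h" for c y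
    proof -
      have "(s1 c 0, s2 c y) \<in> h" using h that unfolding mem_kernel_iff by blast
      then show ?thesis by simp
    qed
  qed
  moreover have "b2 y v \<in> kernel h" if "y \<in> snd ` h" "v \<in> kernel h" for y v
  proof -
    obtain x where "(x, y) \<in> h" using \<open>y \<in> snd ` h\<close> by auto
    with h \<open>v \<in> kernel h\<close> have "(b1 x 0, b2 y v) \<in> h" by (simp add: mem_kernel_iff)
    then show ?thesis by (simp add: mem_kernel_iff b0)
  qed
  ultimately show ?thesis by (simp add: lie_ideal_def)
qed

text \<open>Two elements of \<open>h\<close> with the same first component differ by an element
  \<open>(0, i)\<close> of \<open>h\<close>, that is, by some \<open>i\<close> in the
  kernel.\<close>

lemma fibre_eq_coset:
  assumes "prod_subalgebra h" and xy: "(x, y) \<in> h"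
  shows "{v \<in> snd ` h. (x, v) \<in> h} = coset (kernel h) y"
proof -
  interpret P: vector_space_prod s1 s2 ..
  have sub: "P.p.subspace h" using assms(1) by (simp add: lie_subalgebra_def)
  have "(x, v) \<in> h \<longleftrightarrow> v \<in> coset (kernel h) y" for v
  proof
    assume "(x, v) \<in> h"
    then have "v - y \<in> kernel h"
      using P.p.subspace_diff[OF sub _ xy, of "(x, v)"] by (simp add: mem_kernel_iff)
    then have "y + (v - y) \<in> coset (kernel h) y" unfolding coset_def by (rule imageI)
    then show "v \<in> coset (kernel h) y" by simp
  next
    assume "v \<in> coset (kernel h) y"
    then obtain i where "(0, i) \<in> h" "v = y + i" by (auto simp: coset_def mem_kernel_iff)
    with P.p.subspace_add[OF sub xy] show "(x, v) \<in> h" by force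
  qed
  then show ?thesis by force
qed

lemma quadruple_of_subalgebra_mem:
  assumes h: "prod_subalgebra h"
  shows "quadruple_of_subalgebra h \<in> lie_quadruples s1 b1 s2 b2"
proof -
  define \<alpha> where "\<alpha> = (\<lambda>x1\<in>fst ` h. {x2 \<in> snd ` h. (x1, x2) \<in> h})"
  \<comment> \<open>Any lift \<open>(x, y)\<close> of \<open>x\<close> computes \<alpha> at
    \<open>x\<close>. Sums, multiples and brackets of lifts are again lifts, so the homomorphism
    laws reduce to the coset operations on representatives.\<close>
  have \<alpha>: "\<alpha> x = coset (kernel h) y" if "(x, y) \<in> h" for x y
    using that fibre_eq_coset[OF h that] by (force simp: \<alpha>_def)
  note ideal = lie_ideal_kernel[OF h]
  then have sub: "L2.subspace (kernel h)" by (simp add: lie_ideal_def)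
  note clos = h[unfolded prod_subalgebra_iff]
  let ?Q = "lie_quotient s2 b2 (snd ` h) (kernel h)"
  have "\<alpha> (x + u) = lie_add ?Q (\<alpha> x) (\<alpha> u)"
    "\<alpha> (b1 x u) = lie_bracket ?Q (\<alpha> x) (\<alpha> u)"
    "\<alpha> (s1 c x) = lie_scale ?Q c (\<alpha> x)"
    if x: "x \<in> fst ` h" and u: "u \<in> fst ` h" for x u c
  proof -
    obtain y v where yv: "(x, y) \<in> h" "(u, v) \<in> h" using x u by auto
    then have mem: "y \<in> snd ` h" "v \<in> snd ` h" by force+
    have "(x + u, y + v) \<in> h" "(b1 x u, b2 y v) \<in> h" "(s1 c x, s2 c y) \<in> h"
      using clos yv by blast+
    then show "\<alpha> (x + u) = lie_add ?Q (\<alpha> x) (\<alpha> u)"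
      "\<alpha> (b1 x u) = lie_bracket ?Q (\<alpha> x) (\<alpha> u)"
      "\<alpha> (s1 c x) = lie_scale ?Q c (\<alpha> x)"
      using L2.lie_quotient_add[OF sub] L2.lie_quotient_scale[OF sub]
        L2.lie_quotient_bracket[OF lie_subalgebra_snd[OF h] ideal mem]
      by (simp_all add: \<alpha>[of "x + u"] \<alpha>[of "b1 x u"] \<alpha>[of "s1 c x"]
          \<alpha>[OF yv(1)] \<alpha>[OF yv(2)])
  qed
  \<comment> \<open>Both sides are images of \<open>h\<close> itself, under maps that agree at each
    pair.\<close>
  moreover have "\<alpha> ` fst ` h = coset (kernel h) ` snd ` h"
    unfolding image_image by (rule image_cong) (auto simp: \<alpha>)
  moreover from this have "\<alpha> \<in> fst ` h \<rightarrow> coset (kernel h) ` snd ` h" by blast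
  moreover have "lie_carrier ?Q = coset (kernel h) ` snd ` h"
    by (simp add: lie_quotient_def)
  ultimately have "lie_epi (lie_restrict s1 b1 (fst ` h)) ?Q \<alpha>"
    by (simp add: lie_epi_def lie_hom_def lie_restrict_def)
  then show ?thesis
    using lie_subalgebra_fst[OF h] lie_subalgebra_snd[OF h] ideal
    by (simp add: quadruple_of_subalgebra_def lie_quadruples_def \<alpha>_def kernel_def)
qed

lemma subalgebra_of_quadruple_of_subalgebra:
  "subalgebra_of_quadruple (quadruple_of_subalgebra h) = h"
proof -
  have "x \<in> fst ` h" "y \<in> snd ` h" if "(x, y) \<in> h" for x y
    using that by force+
  then show ?thesis
    unfolding subalgebra_of_quadruple_def quadruple_of_subalgebra_def by auto
qed

section \<open>From quadruples to subalgebras\<close>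

context
  fixes h1 h2 I \<alpha>
  assumes q: "(h1, h2, I, \<alpha>) \<in> lie_quadruples s1 b1 s2 b2"
begin

lemma
  shows quad_h1: "lie_subalgebra s1 b1 h1"
    and quad_h2: "lie_subalgebra s2 b2 h2"
    and quad_I: "lie_ideal s2 b2 h2 I"
    and quad_ext: "\<alpha> \<in> extensional h1"
    and quad_epi: "lie_epi (lie_restrict s1 b1 h1) (lie_quotient s2 b2 h2 I) \<alpha>"
  using q by (auto simp: lie_quadruples_def)

lemma
  shows quad_I_subset: "I \<subseteq> h2"
    and quad_I_subspace: "L2.subspace I"
  using quad_I by (auto simp: lie_ideal_def)

lemma quad_image: "\<alpha> ` h1 = coset I ` h2"
  using quad_epi by (simp add: lie_epi_def lie_restrict_def lie_quotient_def)

lemma quad_add: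
  "x \<in> h1 \<Longrightarrow> u \<in> h1 \<Longrightarrow>
    \<alpha> (x + u) = lie_add (lie_quotient s2 b2 h2 I) (\<alpha> x) (\<alpha> u)"
  and quad_scale: "x \<in> h1 \<Longrightarrow> \<alpha> (s1 c x) = lie_scale (lie_quotient s2 b2 h2 I) c (\<alpha> x)"
  and quad_bracket:
  "x \<in> h1 \<Longrightarrow> u \<in> h1 \<Longrightarrow>
    \<alpha> (b1 x u) = lie_bracket (lie_quotient s2 b2 h2 I) (\<alpha> x) (\<alpha> u)"
  using quad_epi by (simp_all add: lie_epi_def lie_hom_def lie_restrict_def)

text \<open>The value of \<alpha> at \<open>x\<close> is a coset of \<open>I\<close> inside
  \<open>h2\<close>, hence the class of each of its elements. Membership thus becomes an equation
  between cosets, to which the homomorphism laws apply.\<close>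

lemma mem_quad_iff:
  assumes "x \<in> h1"
  shows "v \<in> \<alpha> x \<longleftrightarrow> v \<in> h2 \<and> \<alpha> x = coset I v"
proof
  obtain y where y: "y \<in> h2" "\<alpha> x = coset I y" using assms quad_image by blast
  assume "v \<in> \<alpha> x"
  then obtain i where i: "i \<in> I" "v = y + i" by (auto simp: y coset_def)
  then have "v \<in> h2"
    using quad_h2 y(1) quad_I_subset by (auto simp: lie_subalgebra_def intro: L2.subspace_add)
  moreover have "coset I v = coset I y"
    using i by (simp add: L2.coset_eq_iff[OF quad_I_subspace])
  ultimately show "v \<in> h2 \<and> \<alpha> x = coset I v" using y(2) by simp
qed (simp add: L2.coset_self[OF quad_I_subspace])

lemma mem_subalgebra_of_quadruple_iff:
  "(x, y) \<in> subalgebra_of_quadruple (h1, h2, I, \<alpha>) \<longleftrightarrow>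
     x \<in> h1 \<and> y \<in> h2 \<and> \<alpha> x = coset I y"
  using mem_quad_iff by (auto simp: subalgebra_of_quadruple_def)

text \<open>Preservation of zero is not a clause of \<open>lie_hom\<close>; it follows from
  compatibility with multiplication by the scalar 0. A representative \<open>y\<close> is chosen
  first because the scaling rule of the quotient speaks of cosets \<open>coset I y\<close>.\<close>

lemma quad_zero: "\<alpha> 0 = coset I 0"
proof -
  have "0 \<in> h1" using quad_h1 by (simp add: lie_subalgebra_def L1.subspace_0)
  moreover then obtain y where "\<alpha> 0 = coset I y" using quad_image by blast
  ultimately show ?thesis
    using quad_scale[of 0 0] by (simp add: L2.lie_quotient_scale[OF quad_I_subspace])
qed

text \<open>If \<open>y\<close> and \<open>v\<close> represent the images of \<open>x\<close> and
  \<open>u\<close>, then the homomorphism laws make \<open>y + v\<close>, \<open>s2 c y\<close> and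
  \<open>b2 y v\<close> represent the images of \<open>x + u\<close>, \<open>s1 c x\<close> and
  \<open>b1 x u\<close>.\<close>

lemma prod_subalgebra_subalgebra_of_quadruple:
  "prod_subalgebra (subalgebra_of_quadruple (h1, h2, I, \<alpha>))"
proof -
  have h1: "L1.subspace h1" "\<And>x u. x \<in> h1 \<Longrightarrow> u \<in> h1 \<Longrightarrow> b1 x u \<in> h1"
    and h2: "L2.subspace h2" "\<And>y v. y \<in> h2 \<Longrightarrow> v \<in> h2 \<Longrightarrow> b2 y v \<in> h2"
    using quad_h1 quad_h2 by (auto simp: lie_subalgebra_def)
  show ?thesis
    unfolding prod_subalgebra_iff mem_subalgebra_of_quadruple_iff
    using h1 h2
    by (simp add: quad_zero quad_add quad_scale quad_bracket
        L1.subspace_0 L2.subspace_0 L1.subspace_add L2.subspace_add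
        L1.subspace_scale L2.subspace_scale
        L2.lie_quotient_add[OF quad_I_subspace] L2.lie_quotient_scale[OF quad_I_subspace]
        L2.lie_quotient_bracket[OF quad_h2 quad_I])
qed

lemma quadruple_of_subalgebra_of_quadruple:
  "quadruple_of_subalgebra (subalgebra_of_quadruple (h1, h2, I, \<alpha>)) = (h1, h2, I, \<alpha>)"
proof -
  define h where "h = subalgebra_of_quadruple (h1, h2, I, \<alpha>)"
  have mem: "(x, y) \<in> h \<longleftrightarrow> x \<in> h1 \<and> y \<in> h2 \<and> \<alpha> x = coset I y" for x y
    unfolding h_def by (rule mem_subalgebra_of_quadruple_iff)
  \<comment> \<open>Each value of \<alpha> is the class of some element of \<open>h2\<close>, so no
    fibre over \<open>h1\<close> is empty.\<close>
  have fst: "fst ` h = h1"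
  proof
    show "h1 \<subseteq> fst ` h"
    proof
      fix x assume "x \<in> h1"
      then have "\<alpha> x \<in> coset I ` h2" using quad_image by blast
      then obtain y where "y \<in> h2" "\<alpha> x = coset I y" by (rule imageE)
      with \<open>x \<in> h1\<close> have "(x, y) \<in> h" by (simp add: mem)
      then show "x \<in> fst ` h" by force
    qed
  qed (auto simp: mem)
  \<comment> \<open>Here surjectivity of \<alpha> enters: every class of an element of
    \<open>h2\<close> is attained.\<close>
  have snd: "snd ` h = h2"
  proof
    show "h2 \<subseteq> snd ` h"
    proof
      fix y assume "y \<in> h2"
      then have "coset I y \<in> \<alpha> ` h1" using quad_image by simp
      then obtain x where "x \<in> h1" "coset I y = \<alpha> x" by (rule imageE)
      with \<open>y \<in> h2\<close> have "(x, y) \<in> h" by (simp add: mem)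
      then show "y \<in> snd ` h" by force
    qed
  qed (auto simp: mem)
  have "0 \<in> h1" using quad_h1 by (simp add: lie_subalgebra_def L1.subspace_0)
  \<comment> \<open>\<open>(0, y)\<close> lies in \<open>h\<close> exactly when \<open>y\<close> is
    in \<open>h2\<close> and has the same coset as 0. The coset criterion yields \<open>- y\<close>
    in \<open>I\<close>, and closure under negation turns this into \<open>y\<close> in
    \<open>I\<close>.\<close>
  then have "y \<in> kernel h \<longleftrightarrow> y \<in> I" for y
    using quad_I_subset L2.subspace_neg[OF quad_I_subspace, of "- y"]
      L2.subspace_neg[OF quad_I_subspace, of y]
    by (auto simp: mem_kernel_iff mem quad_zero L2.coset_eq_iff[OF quad_I_subspace])
  then have ker: "snd ` (h \<inter> {0} \<times> UNIV) = I" by (auto simp flip: kernel_def)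
  have "(\<lambda>x1\<in>h1. {x2 \<in> h2. (x1, x2) \<in> h}) = \<alpha>"
  \<comment> \<open>Outside \<open>h1\<close> both functions are \<open>undefined\<close>, so only
    points of \<open>h1\<close> have to be compared.\<close>
  proof (rule extensionalityI[OF restrict_extensional quad_ext])
    fix x assume "x \<in> h1"
    then show "(\<lambda>x1\<in>h1. {x2 \<in> h2. (x1, x2) \<in> h}) x = \<alpha> x"
      using mem_quad_iff by (auto simp: mem)
  qed
  then show ?thesis
    unfolding h_def[symmetric] by (simp add: quadruple_of_subalgebra_def fst snd ker)
qed

end

end

text \<open>Each conjunct pairs well-definedness of one map with the identity for the composite that
  starts with it; together they make the two maps mutually inverse.\<close>

theorem proposition3:
  fixes s1 :: "'k::field \<Rightarrow> 'a::ab_group_add \<Rightarrow> 'a" and b1 :: "'a \<Rightarrow> 'a \<Rightarrow> 'a"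
    and s2 :: "'k \<Rightarrow> 'b::ab_group_add \<Rightarrow> 'b" and b2 :: "'b \<Rightarrow> 'b \<Rightarrow> 'b"
  assumes "real_or_complex_field TYPE('k)"
    and "finite_dimensional_lie_algebra s1 b1"
    and "finite_dimensional_lie_algebra s2 b2"
  shows "(\<forall>h. lie_subalgebra (module_prod.scale s1 s2) (prod_bracket b1 b2) h \<longrightarrow>
            quadruple_of_subalgebra h \<in> lie_quadruples s1 b1 s2 b2 \<and>
            subalgebra_of_quadruple (quadruple_of_subalgebra h) = h) \<and>
         (\<forall>q\<in>lie_quadruples s1 b1 s2 b2.
            lie_subalgebra (module_prod.scale s1 s2) (prod_bracket b1 b2)
              (subalgebra_of_quadruple q) \<and>
            quadruple_of_subalgebra (subalgebra_of_quadruple q) = q)"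
proof -
  interpret A: finite_dimensional_lie_algebra s1 b1 by fact
  interpret B: finite_dimensional_lie_algebra s2 b2 by fact
  interpret lie_algebra_pair s1 b1 s2 b2 ..
  show ?thesis
    using quadruple_of_subalgebra_mem subalgebra_of_quadruple_of_subalgebra
      prod_subalgebra_subalgebra_of_quadruple quadruple_of_subalgebra_of_quadruple
    by auto
qed

end
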